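(* Let $a<b$ be real numbers, let $f:[a,b)\to\mathbb{R}$ be continuously differentiable, and let $\Phi:[0,b-a]\to[0,\infty)$ be continuously differentiable with $\Phi'\ge0$ and $\Phi(0)=0$. Assume that $f'$ is $\Phi'$-superadditive, i.e. $f'(y)-f'(x)\ge\Phi'(y-x)$ for all $x\le y$ in $[a,b)$. Let $x_1\le x_2\le\dots\le x_n$ be points of $[a,b)$. Let $\mathbf{p}=(p_1,\dots,p_n)$ and $\mathbf{q}=(q_1,\dots,q_n)$ be real $n$-tuples with $\mathbf{p}\ne\mathbf{q}$, $\sum_{i=1}^n p_i=\sum_{i=1}^n q_i=1$, $0\le\sum_{j=1}^i p_j\le1$ for $i=1,\dots,n$, and $0<\sum_{j=1}^i q_j<1$ for $i=1,\dots,n-1$. Put $$m_i=\frac{\sum_{j=1}^i p_j}{\sum_{j=1}^i q_j},\qquad \overline{m}_i=\frac{\sum_{j=i}^n p_j}{\sum_{j=i}^n q_j},\qquad i=1,\dots,n,$$ $$m^*=\min_{1\le i\le n}\{m_i,\overline{m}_i\},\qquad M^*=\max_{1\le i\le n}\{m_i,\overline{m}_i\}.$$ Then $$J_n(f,\mathbf{x},\mathbf{p})-m^*J_n(f,\mathbf{x},\mathbf{q})\ge m^*\Phi\left(\left|\sum_{i=1}^n(q_i-p_i)x_i\right|\right)+\sum_{i=1}^n(p_i-m^*q_i)\Phi\left(\left|x_i-\sum_{j=1}^n p_jx_j\right|\right)$$ and $$J_n(f,\mathbf{x},\mathbf{p})-M^*J_n(f,\mathbf{x},\mathbf{q})\le-\sum_{i=1}^n(M^*q_i-p_i)\Phi\left(\left|x_i-\sum_{j=1}^n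 q_jx_j\right|\right)-\Phi\left(\left|\sum_{i=1}^n(p_i-q_i)x_i\right|\right).$$
   Context: For $\mathbf{x}=(x_1,\dots,x_n)$ and $\mathbf{p}=(p_1,\dots,p_n)$, the Jensen functional is $J_n(f,\mathbf{x},\mathbf{p})=\sum_{i=1}^n p_if(x_i)-f\left(\sum_{i=1}^n p_ix_i\right)$. The entries of $\mathbf{p},\mathbf{q}$ may be negative. Derivatives at closed endpoints are one-sided. *)

theory Defs
  imports Complex_Main
begin

text \<open>
  An \<open>n\<close>-tuple is a function on \<open>nat\<close> of which only the values at \<open>1, \<dots>, n\<close> matter.
\<close>

definition jensen_functional ::
    "nat \<Rightarrow> (real \<Rightarrow> real) \<Rightarrow> (nat \<Rightarrow> real) \<Rightarrow> (nat \<Rightarrow> real) \<Rightarrow> real" where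
  "jensen_functional n f x p = (\<Sum>i=1..n. p i * f (x i)) - f (\<Sum>i=1..n. p i * x i)"

definition head_ratio :: "(nat \<Rightarrow> real) \<Rightarrow> (nat \<Rightarrow> real) \<Rightarrow> nat \<Rightarrow> real" where
  "head_ratio p q i = (\<Sum>j=1..i. p j) / (\<Sum>j=1..i. q j)"

definition tail_ratio :: "nat \<Rightarrow> (nat \<Rightarrow> real) \<Rightarrow> (nat \<Rightarrow> real) \<Rightarrow> nat \<Rightarrow> real" where
  "tail_ratio n p q i = (\<Sum>j=i..n. p j) / (\<Sum>j=i..n. q j)"

definition min_ratio :: "nat \<Rightarrow> (nat \<Rightarrow> real) \<Rightarrow> (nat \<Rightarrow> real) \<Rightarrow> real" where
  "min_ratio n p q = Min (head_ratio p q ` {1..n} \<union> tail_ratio n p q ` {1..n})"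

definition max_ratio :: "nat \<Rightarrow> (nat \<Rightarrow> real) \<Rightarrow> (nat \<Rightarrow> real) \<Rightarrow> real" where
  "max_ratio n p q = Max (head_ratio p q ` {1..n} \<union> tail_ratio n p q ` {1..n})"

end

theory Submission
  imports Defs
begin

text \<open>
  For a base point \<open>c\<close> the function \<open>g t = f t - f c - f' c * (t - c) - \<Phi> \<bar>t - c\<bar>\<close> vanishes at \<open>c\<close>,
  and superadditivity makes it decreasing to the left and increasing to the right of \<open>c\<close>.
  Abel summation on each side of \<open>c\<close> then gives \<open>(\<Sum>i=1..n. w i * g (x i)) \<ge> 0\<close> for all weights
  whose head and tail sums are nonnegative. The first inequality is this for the weights
  \<open>p - m\<^sup>* q\<close> together with mass \<open>m\<^sup>*\<close> at \<open>\<Sum>i. q i * x i\<close>, based at \<open>c = (\<Sum>i. p i * x i)\<close>; the second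
  is the case of the weights \<open>M\<^sup>* q - p\<close> together with mass \<open>1\<close> at \<open>\<Sum>i. p i * x i\<close>, based at
  \<open>c = (\<Sum>i. q i * x i)\<close>. In both cases \<open>c\<close> is the barycentre, so the linear part of \<open>g\<close> drops out.
\<close>

section \<open>Abel summation for weights of mixed sign\<close>

text \<open>Abel summation as an induction: the head mass collected so far is nonnegative, so
  lowering its common value from \<open>y k\<close> to \<open>y (Suc k)\<close> can only decrease
  the bound. Signs of single weights never enter.\<close>

lemma weighted_sum_antimono_ge:
  fixes w y :: "nat \<Rightarrow> real"
  assumes "\<And>i. 1 \<le> i \<Longrightarrow> i \<le> k \<Longrightarrow> 0 \<le> (\<Sum>j=1..i. w j)"
    and "\<And>i. 1 \<le> i \<Longrightarrow> Suc i \<le> k \<Longrightarrow> y (Suc i) \<le> y i"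
  shows "(\<Sum>j=1..k. w j) * y k \<le> (\<Sum>j=1..k. w j * y j)"
  using assms
proof (induction k)
  case (Suc k)
  have "(\<Sum>j=1..k. w j) * y (Suc k) \<le> (\<Sum>j=1..k. w j) * y k"
  proof (cases "k = 0")
    case False
    then show ?thesis using Suc.prems(1)[of k] Suc.prems(2)[of k] by (intro mult_left_mono) auto
  qed simp
  also have "\<dots> \<le> (\<Sum>j=1..k. w j * y j)"
    using Suc.prems by (intro Suc.IH) auto
  finally show ?case by (simp add: algebra_simps)
qed simp

text \<open>The mirror image, by downward induction from \<open>n\<close>: tail masses take the
  place of head masses and the first value that of the last.\<close>

lemma weighted_sum_mono_ge:
  fixes w y :: "nat \<Rightarrow> real"
  assumes "k \<le> n"
    and "\<And>i. k \<le> i \<Longrightarrow> i \<le> n \<Longrightarrow> 0 \<le> (\<Sum>j=i..n. w j)"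
    and "\<And>i. k \<le> i \<Longrightarrow> Suc i \<le> n \<Longrightarrow> y i \<le> y (Suc i)"
  shows "(\<Sum>j=k..n. w j) * y k \<le> (\<Sum>j=k..n. w j * y j)"
  using assms
proof (induction k rule: inc_induct)
  case (step k)
  have "(\<Sum>j=Suc k..n. w j) * y k \<le> (\<Sum>j=Suc k..n. w j) * y (Suc k)"
    using step by (intro mult_left_mono) auto
  also have "\<dots> \<le> (\<Sum>j=Suc k..n. w j * y j)"
    using step by simp
  finally show ?case
    using step(2) by (simp add: sum.atLeast_Suc_atMost algebra_simps)
qed simp

text \<open>Cut the tuple where it passes \<open>c\<close>. Head sums control the descending part
  and tail sums the ascending part; each part is bounded below by a nonnegative mass times a
  nonnegative value of \<open>g\<close> at the point next to the cut.\<close>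

lemma weighted_sum_valley_nonneg:
  fixes w x :: "nat \<Rightarrow> real" and g :: "real \<Rightarrow> real"
  assumes x: "\<And>i. i \<in> {1..n} \<Longrightarrow> x i \<in> S"
    and mono_x: "\<And>i j. i \<in> {1..n} \<Longrightarrow> j \<in> {1..n} \<Longrightarrow> i \<le> j \<Longrightarrow> x i \<le> x j"
    and heads: "\<And>i. i \<in> {1..n} \<Longrightarrow> 0 \<le> (\<Sum>j=1..i. w j)"
    and tails: "\<And>i. i \<in> {1..n} \<Longrightarrow> 0 \<le> (\<Sum>j=i..n. w j)"
    and left: "\<And>s t. s \<in> S \<Longrightarrow> t \<in> S \<Longrightarrow> s \<le> t \<Longrightarrow> t \<le> c \<Longrightarrow> g t \<le> g s"
    and right: "\<And>s t. s \<in> S \<Longrightarrow> t \<in> S \<Longrightarrow> s \<le> t \<Longrightarrow> c \<le> s \<Longrightarrow> g s \<le> g t"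
    and nonneg: "\<And>t. t \<in> S \<Longrightarrow> 0 \<le> g t"
  shows "0 \<le> (\<Sum>i=1..n. w i * g (x i))"
proof -
  \<comment> \<open>The added 0 makes \<open>Max A\<close> meaningful even if every point lies to
    the right of \<open>c\<close>; then \<open>k = 0\<close> and the left part is empty.\<close>
  define A where "A = insert 0 {i \<in> {1..n}. x i \<le> c}"
  define k where "k = Max A"
  have fin: "finite A" and ne: "A \<noteq> {}" by (auto simp: A_def)
  have kA: "k \<in> A" unfolding k_def using fin ne by (rule Max_in)
  have kn: "k \<le> n" using kA by (auto simp: A_def)
  have le: "x i \<le> c" if "1 \<le> i" "i \<le> k" for i
    using that kA mono_x[of i k] by (auto simp: A_def)
  have ge: "c \<le> x i" if "k < i" "i \<le> n" for i
  proof (rule ccontr)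
    assume "\<not> c \<le> x i"
    then have "i \<in> A" using that by (auto simp: A_def)
    then have "i \<le> k" unfolding k_def using fin by simp
    with that show False by simp
  qed
  have "0 \<le> (\<Sum>i=1..k. w i * g (x i))"
  proof (cases "k = 0")
    case False
    have "0 \<le> (\<Sum>i=1..k. w i) * g (x k)"
      using False kn by (intro mult_nonneg_nonneg heads nonneg x) auto
    also have "\<dots> \<le> (\<Sum>i=1..k. w i * g (x i))"
      using kn by (intro weighted_sum_antimono_ge heads left x mono_x le) auto
    finally show ?thesis .
  qed simp
  moreover have "0 \<le> (\<Sum>i=Suc k..n. w i * g (x i))"
  proof (cases "k = n")
    case False
    have "0 \<le> (\<Sum>i=Suc k..n. w i) * g (x (Suc k))"
      using False kn by (intro mult_nonneg_nonneg tails nonneg x) auto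
    also have "\<dots> \<le> (\<Sum>i=Suc k..n. w i * g (x i))"
      using False kn by (intro weighted_sum_mono_ge tails right x mono_x ge) auto
    finally show ?thesis .
  qed simp
  moreover have "(\<Sum>i=1..n. w i * g (x i))
      = (\<Sum>i=1..k. w i * g (x i)) + (\<Sum>i=Suc k..n. w i * g (x i))"
    using sum.ub_add_nat[of 1 k "\<lambda>i. w i * g (x i)" "n - k"] kn by simp
  ultimately show ?thesis by simp
qed

text \<open>With negative weights the mean is no convex combination, so its place in the domain of
  \<open>f\<close> needs an argument. Apply the valley lemma to the distance from \<open>x 1\<close>
  or from \<open>x n\<close>: all absolute values then open with the same sign.\<close>

lemma steffensen_mean_bounds:
  fixes w x :: "nat \<Rightarrow> real"
  assumes "1 \<le> n"
    and mono_x: "\<And>i j. i \<in> {1..n} \<Longrightarrow> j \<in> {1..n} \<Longrightarrow> i \<le> j \<Longrightarrow> x i \<le> x j"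
    and heads: "\<And>i. i \<in> {1..n} \<Longrightarrow> 0 \<le> (\<Sum>j=1..i. w j)"
    and tails: "\<And>i. i \<in> {1..n} \<Longrightarrow> 0 \<le> (\<Sum>j=i..n. w j)"
    and total: "(\<Sum>j=1..n. w j) = 1"
  shows "x 1 \<le> (\<Sum>j=1..n. w j * x j)" and "(\<Sum>j=1..n. w j * x j) \<le> x n"
proof -
  have *: "0 \<le> (\<Sum>i=1..n. w i * \<bar>x i - c\<bar>)" for c
    by (rule weighted_sum_valley_nonneg[where S = UNIV and c = c and g = "\<lambda>t. \<bar>t - c\<bar>"])
       (use mono_x heads tails in auto)
  have "(\<Sum>i=1..n. w i * \<bar>x i - x 1\<bar>) = (\<Sum>i=1..n. w i * x i - x 1 * w i)"
    using mono_x[of 1] by (intro sum.cong) (auto simp: algebra_simps)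
  then show "x 1 \<le> (\<Sum>j=1..n. w j * x j)"
    using *[of "x 1"] total by (simp add: sum_subtractf flip: sum_distrib_left)
  have "(\<Sum>i=1..n. w i * \<bar>x i - x n\<bar>) = (\<Sum>i=1..n. x n * w i - w i * x i)"
  proof (intro sum.cong refl)
    fix i assume "i \<in> {1..n}"
    then have "x i \<le> x n" using mono_x[of i n] by auto
    then show "w i * \<bar>x i - x n\<bar> = x n * w i - w i * x i"
      by (simp add: abs_of_nonpos algebra_simps)
  qed
  then show "(\<Sum>j=1..n. w j * x j) \<le> x n"
    using *[of "x n"] total by (simp add: sum_subtractf flip: sum_distrib_left)
qed

section \<open>The gap function and the inequality with barycentre \<open>c\<close>\<close>

locale superadditive_derivative =
  fixes a b :: real and f f' \<Phi> \<Phi>' :: "real \<Rightarrow> real"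
  assumes f_deriv: "\<And>t. t \<in> {a..<b} \<Longrightarrow> (f has_real_derivative f' t) (at t within {a..<b})"
    and Phi_deriv: "\<And>t. t \<in> {0..b - a} \<Longrightarrow> (\<Phi> has_real_derivative \<Phi>' t) (at t within {0..b - a})"
    and Phi_0: "\<Phi> 0 = 0"
    and superadd: "\<And>s t. s \<in> {a..<b} \<Longrightarrow> t \<in> {a..<b} \<Longrightarrow> s \<le> t \<Longrightarrow> f' t - f' s \<ge> \<Phi>' (t - s)"
begin

text \<open>The excess of \<open>f\<close> over its tangent at \<open>c\<close>, reduced by
  \<open>\<Phi>\<close> of the distance from \<open>c\<close>.\<close>

definition gap :: "real \<Rightarrow> real \<Rightarrow> real" where
  "gap c t = f t - f c - f' c * (t - c) - \<Phi> \<bar>t - c\<bar>"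

lemma gap_self [simp]: "gap c c = 0"
  by (simp add: gap_def Phi_0)

lemma continuous_on_f: "continuous_on {a..<b} f"
  by (rule DERIV_continuous_on) (rule f_deriv)

lemma continuous_on_Phi: "continuous_on {0..b - a} \<Phi>"
  by (rule DERIV_continuous_on) (rule Phi_deriv)

text \<open>The monotonicity rules applied to \<open>gap\<close> take two-sided derivatives inside
  an interval and continuity up to its ends.\<close>

lemma f_deriv_at: "(f has_real_derivative f' t) (at t)" if "a < t" "t < b"
proof -
  have "(f has_real_derivative f' t) (at t within {a<..<b})"
    using that by (intro DERIV_subset[OF f_deriv]) auto
  then show ?thesis using that by (simp add: at_within_open[of t "{a<..<b}"])
qed

lemma Phi_deriv_at: "(\<Phi> has_real_derivative \<Phi>' t) (at t)" if "0 < t" "t < b - a"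
proof -
  have "(\<Phi> has_real_derivative \<Phi>' t) (at t within {0<..<b - a})"
    using that by (intro DERIV_subset[OF Phi_deriv]) auto
  then show ?thesis using that by (simp add: at_within_open[of t "{0<..<b - a}"])
qed

lemma continuous_on_gap:
  assumes "c \<in> {a..<b}" "T \<subseteq> {a..<b}"
  shows "continuous_on T (gap c)"
proof -
  have "\<bar>t - c\<bar> \<le> b - a" if "t \<in> T" for t
  proof -
    have "t \<in> {a..<b}" using that assms(2) by blast
    then show ?thesis using assms(1) by auto
  qed
  then have "continuous_on T (\<lambda>t. \<Phi> \<bar>t - c\<bar>)"
    by (intro continuous_on_compose2[OF continuous_on_Phi] continuous_intros) auto
  then show ?thesis
    unfolding gap_def using continuous_on_subset[OF continuous_on_f assms(2)]
    by (intro continuous_intros)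
qed

text \<open>To the right of \<open>c\<close> the derivative is
  \<open>f' z - f' c - \<Phi>' (z - c)\<close>, nonnegative by superadditivity for the pair
  \<open>c\<close>, \<open>z\<close>.\<close>

lemma gap_mono_right:
  assumes "a \<le> c" "c \<le> s" "s \<le> t" "t < b"
  shows "gap c s \<le> gap c t"
proof (rule DERIV_nonneg_imp_increasing_open[where f = "gap c"])
  show "s \<le> t" by (rule assms)
next
  fix z assume z: "s < z" "z < t"
  have "((\<lambda>t. f t - f c - f' c * (t - c) - \<Phi> (t - c)) has_real_derivative
      f' z - f' c - \<Phi>' (z - c)) (at z)"
    using z assms
    by (auto intro!: derivative_eq_intros f_deriv_at
        DERIV_chain2[where f = \<Phi> and g = "\<lambda>t. t - c", OF Phi_deriv_at])
  \<comment> \<open>The absolute value is removed only locally: \<open>z\<close> lies strictly to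
    the right of \<open>c\<close>, so the two functions agree on a neighbourhood of
    \<open>z\<close>.\<close>
  moreover have "(gap c has_real_derivative D) (at z) \<longleftrightarrow>
      ((\<lambda>t. f t - f c - f' c * (t - c) - \<Phi> (t - c)) has_real_derivative D) (at z)" for D
    using z assms
    by (intro DERIV_cong_ev refl eventually_mono[OF eventually_nhds_in_open[of "{c<..}" z]])
      (auto simp: gap_def)
  moreover have "0 \<le> f' z - f' c - \<Phi>' (z - c)"
    using superadd[of c z] z assms by simp
  ultimately show "\<exists>y. (gap c has_real_derivative y) (at z) \<and> 0 \<le> y" by blast
next
  show "continuous_on {s..t} (gap c)"
    using assms by (intro continuous_on_gap) auto
qed

text \<open>To the left of \<open>c\<close> the distance is \<open>c - z\<close>, which flips the
  sign of the \<open>\<Phi>'\<close> term; superadditivity for the pair \<open>z\<close>,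
  \<open>c\<close> makes the derivative nonpositive.\<close>

lemma gap_antimono_left:
  assumes "a \<le> s" "s \<le> t" "t \<le> c" "c < b"
  shows "gap c t \<le> gap c s"
proof (rule DERIV_nonpos_imp_decreasing_open[where f = "gap c"])
  show "s \<le> t" by (rule assms)
next
  fix z assume z: "s < z" "z < t"
  have "((\<lambda>t. f t - f c - f' c * (t - c) - \<Phi> (c - t)) has_real_derivative
      f' z - f' c + \<Phi>' (c - z)) (at z)"
    using z assms
    by (auto intro!: derivative_eq_intros f_deriv_at
        DERIV_chain2[where f = \<Phi> and g = "\<lambda>t. c - t", OF Phi_deriv_at])
  moreover have "(gap c has_real_derivative D) (at z) \<longleftrightarrow>
      ((\<lambda>t. f t - f c - f' c * (t - c) - \<Phi> (c - t)) has_real_derivative D) (at z)" for D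
    using z assms
    by (intro DERIV_cong_ev refl eventually_mono[OF eventually_nhds_in_open[of "{..<c}" z]])
      (auto simp: gap_def)
  moreover have "f' z - f' c + \<Phi>' (c - z) \<le> 0"
    using superadd[of z c] z assms by simp
  ultimately show "\<exists>y. (gap c has_real_derivative y) (at z) \<and> y \<le> 0" by blast
next
  show "continuous_on {s..t} (gap c)"
    using assms by (intro continuous_on_gap) auto
qed

lemma gap_nonneg:
  assumes "c \<in> {a..<b}" "t \<in> {a..<b}"
  shows "0 \<le> gap c t"
  using assms gap_mono_right[of c c t] gap_antimono_left[of t c c] by (cases "c \<le> t") auto

text \<open>The extra mass \<open>r\<close> at \<open>d\<close> stays outside the tuple, so
  \<open>d\<close> need not be sorted in among the points: its term \<open>r * gap c d\<close> is
  nonnegative by itself. The total mass \<open>R\<close> is left general because the two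
  applications have totals 1 and \<open>M\<^sup>*\<close>.\<close>

lemma jensen_steffensen_superadditive:
  fixes w x :: "nat \<Rightarrow> real"
  assumes x: "\<And>i. i \<in> {1..n} \<Longrightarrow> x i \<in> {a..<b}"
    and mono_x: "\<And>i j. i \<in> {1..n} \<Longrightarrow> j \<in> {1..n} \<Longrightarrow> i \<le> j \<Longrightarrow> x i \<le> x j"
    and heads: "\<And>i. i \<in> {1..n} \<Longrightarrow> 0 \<le> (\<Sum>j=1..i. w j)"
    and tails: "\<And>i. i \<in> {1..n} \<Longrightarrow> 0 \<le> (\<Sum>j=i..n. w j)"
    and c: "c \<in> {a..<b}" and d: "d \<in> {a..<b}" and r: "0 \<le> r"
    and total: "(\<Sum>i=1..n. w i) + r = R"
    and centre: "(\<Sum>i=1..n. w i * x i) + r * d = R * c"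
  shows "R * f c \<le> (\<Sum>i=1..n. w i * (f (x i) - \<Phi> \<bar>x i - c\<bar>)) + r * (f d - \<Phi> \<bar>d - c\<bar>)"
proof -
  have weights: "(\<Sum>i=1..n. w i) = R - r" using total by simp
  have moment: "(\<Sum>i=1..n. w i * x i) = R * c - r * d" using centre by simp
  have "0 \<le> (\<Sum>i=1..n. w i * gap c (x i))"
    by (rule weighted_sum_valley_nonneg[where S = "{a..<b}" and c = c])
      (use x mono_x heads tails c gap_mono_right gap_antimono_left gap_nonneg in auto)
  moreover have "0 \<le> r * gap c d"
    using r gap_nonneg[OF c d] by simp
  moreover have "(\<Sum>i=1..n. w i * gap c (x i)) =
      (\<Sum>i=1..n. w i * (f (x i) - \<Phi> \<bar>x i - c\<bar>) - f c * w i
        - f' c * (w i * x i) + f' c * c * w i)"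
    by (intro sum.cong) (auto simp: gap_def algebra_simps)
  then have "(\<Sum>i=1..n. w i * gap c (x i)) =
      (\<Sum>i=1..n. w i * (f (x i) - \<Phi> \<bar>x i - c\<bar>)) - f c * (R - r)
        - f' c * (R * c - r * d) + f' c * c * (R - r)"
    by (simp only: sum.distrib sum_subtractf weights moment flip: sum_distrib_left)
  ultimately have "0 \<le> (\<Sum>i=1..n. w i * (f (x i) - \<Phi> \<bar>x i - c\<bar>)) - f c * (R - r)
      - f' c * (R * c - r * d) + f' c * c * (R - r) + r * gap c d"
    by linarith
  \<comment> \<open>As \<open>c\<close> is the barycentre of the whole mass, the tangent terms of
    the tuple cancel those of \<open>r * gap c d\<close>.\<close>
  also have "\<dots> = (\<Sum>i=1..n. w i * (f (x i) - \<Phi> \<bar>x i - c\<bar>)) + r * (f d - \<Phi> \<bar>d - c\<bar>) - R * f c"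
    by (simp only: gap_def) algebra
  finally show ?thesis by simp
qed

end

section \<open>From the ratios to the two Jensen inequalities\<close>

text \<open>Turns the hypotheses on head sums of \<open>p\<close> and \<open>q\<close> into bounds
  on their tail sums.\<close>

lemma sum_tail_eq:
  fixes w :: "nat \<Rightarrow> real"
  assumes "i \<in> {1..n}"
  shows "(\<Sum>j=i..n. w j) = (\<Sum>j=1..n. w j) - (\<Sum>j=1..i - 1. w j)"
proof (cases i)
  case (Suc k)
  then show ?thesis using sum.ub_add_nat[of 1 k w "n - k"] assms by simp
qed (use assms in simp)

theorem theorem20:
  fixes a b :: real
    and f f' \<Phi> \<Phi>' :: "real \<Rightarrow> real"
    and n :: nat
    and x p q :: "nat \<Rightarrow> real"
  assumes "a < b"
    and "\<And>t. t \<in> {a..<b} \<Longrightarrow> (f has_real_derivative f' t) (at t within {a..<b})"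
    and "continuous_on {a..<b} f'"
    and "\<And>t. t \<in> {0..b - a} \<Longrightarrow> (\<Phi> has_real_derivative \<Phi>' t) (at t within {0..b - a})"
    and "continuous_on {0..b - a} \<Phi>'"
    and "\<And>t. t \<in> {0..b - a} \<Longrightarrow> 0 \<le> \<Phi> t"
    and "\<And>t. t \<in> {0..b - a} \<Longrightarrow> 0 \<le> \<Phi>' t"
    and "\<Phi> 0 = 0"
    and "\<And>s t. s \<in> {a..<b} \<Longrightarrow> t \<in> {a..<b} \<Longrightarrow> s \<le> t \<Longrightarrow> f' t - f' s \<ge> \<Phi>' (t - s)"
    and "\<And>i. i \<in> {1..n} \<Longrightarrow> x i \<in> {a..<b}"
    and "\<And>i j. i \<in> {1..n} \<Longrightarrow> j \<in> {1..n} \<Longrightarrow> i \<le> j \<Longrightarrow> x i \<le> x j"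
    and "\<exists>i\<in>{1..n}. p i \<noteq> q i"
    and "(\<Sum>i=1..n. p i) = 1"
    and "(\<Sum>i=1..n. q i) = 1"
    and "\<And>i. i \<in> {1..n} \<Longrightarrow> 0 \<le> (\<Sum>j=1..i. p j) \<and> (\<Sum>j=1..i. p j) \<le> 1"
    and "\<And>i. i \<in> {1..n - 1} \<Longrightarrow> 0 < (\<Sum>j=1..i. q j) \<and> (\<Sum>j=1..i. q j) < 1"
  shows "jensen_functional n f x p - min_ratio n p q * jensen_functional n f x q
           \<ge> min_ratio n p q * \<Phi> \<bar>\<Sum>i=1..n. (q i - p i) * x i\<bar>
             + (\<Sum>i=1..n. (p i - min_ratio n p q * q i) * \<Phi> \<bar>x i - (\<Sum>j=1..n. p j * x j)\<bar>)
       \<and> jensen_functional n f x p - max_ratio n p q * jensen_functional n f x q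
           \<le> - (\<Sum>i=1..n. (max_ratio n p q * q i - p i) * \<Phi> \<bar>x i - (\<Sum>j=1..n. q j * x j)\<bar>)
             - \<Phi> \<bar>\<Sum>i=1..n. (p i - q i) * x i\<bar>"
proof -
  let ?m = "min_ratio n p q" and ?M = "max_ratio n p q"
  define u where "u = (\<Sum>j=1..n. p j * x j)"
  define v where "v = (\<Sum>j=1..n. q j * x j)"
  interpret superadditive_derivative a b f f' \<Phi> \<Phi>'
    by unfold_locales (fact assms)+
  note x = \<open>\<And>i. i \<in> {1..n} \<Longrightarrow> x i \<in> {a..<b}\<close>
  note mono_x = \<open>\<And>i j. i \<in> {1..n} \<Longrightarrow> j \<in> {1..n} \<Longrightarrow> i \<le> j \<Longrightarrow> x i \<le> x j\<close>
  note p1 = \<open>(\<Sum>i=1..n. p i) = 1\<close> and q1 = \<open>(\<Sum>i=1..n. q i) = 1\<close>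
  have n: "1 \<le> n" using assms(12) by auto
  have p_head: "0 \<le> (\<Sum>j=1..i. p j)" and p_head_le: "(\<Sum>j=1..i. p j) \<le> 1" if "i \<in> {1..n}" for i
    using assms(15)[OF that] by auto
  have q_head: "0 < (\<Sum>j=1..i. q j)" if "i \<in> {1..n}" for i
    using assms(16)[of i] q1 that by (cases "i = n") auto
  have p_tail: "0 \<le> (\<Sum>j=i..n. p j)" if "i \<in> {1..n}" for i
  proof (cases "i = 1")
    case False
    then have "i - 1 \<in> {1..n}" using that by auto
    then show ?thesis using p_head_le sum_tail_eq[OF that, of p] p1 by simp
  qed (use p1 in simp)
  \<comment> \<open>A tail is 1 minus the head ending one index earlier, and the strict upper bound
    keeps that head below 1; for \<open>i = 1\<close> the tail is the total mass.\<close>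
  have q_tail: "0 < (\<Sum>j=i..n. q j)" if "i \<in> {1..n}" for i
  proof (cases "i = 1")
    case False
    then have "i - 1 \<in> {1..n - 1}" using that by auto
    then show ?thesis using assms(16) sum_tail_eq[OF that, of q] q1 by simp
  qed (use q1 in simp)
  have u: "u \<in> {a..<b}"
    using steffensen_mean_bounds[of n x p, OF n mono_x p_head p_tail p1] x[of 1] x[of n] n
    by (auto simp: u_def)
  have v: "v \<in> {a..<b}"
    using steffensen_mean_bounds[of n x q, OF n mono_x less_imp_le[OF q_head] less_imp_le[OF q_tail] q1]
      x[of 1] x[of n] n
    by (auto simp: v_def)

  let ?R = "head_ratio p q ` {1..n} \<union> tail_ratio n p q ` {1..n}"
  have R: "finite ?R" "?R \<noteq> {}" using n by auto
  have "0 \<le> r" if "r \<in> ?R" for r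
    using that p_head q_head p_tail q_tail
    by (auto simp: head_ratio_def tail_ratio_def intro!: divide_nonneg_pos)
  \<comment> \<open>Needed because \<open>?m\<close> serves as the extra mass \<open>r\<close> in
    the first inequality.\<close>
  then have m0: "0 \<le> ?m"
    unfolding min_ratio_def using R by simp
  \<comment> \<open>Clearing the positive denominators turns extremality of \<open>?m\<close> and
    \<open>?M\<close> into nonnegative head sums of \<open>p - ?m q\<close> and
    \<open>?M q - p\<close>; the tail ratios do the same for the tails.\<close>
  have m_head: "?m * (\<Sum>j=1..i. q j) \<le> (\<Sum>j=1..i. p j)"
    and M_head: "(\<Sum>j=1..i. p j) \<le> ?M * (\<Sum>j=1..i. q j)" if "i \<in> {1..n}" for i
  proof -
    have "head_ratio p q i \<in> ?R" using that by simp
    then have "?m \<le> head_ratio p q i" "head_ratio p q i \<le> ?M"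
      unfolding min_ratio_def max_ratio_def using R(1) by simp_all
    then show "?m * (\<Sum>j=1..i. q j) \<le> (\<Sum>j=1..i. p j)" "(\<Sum>j=1..i. p j) \<le> ?M * (\<Sum>j=1..i. q j)"
      using q_head[OF that] by (simp_all add: head_ratio_def field_simps)
  qed
  have m_tail: "?m * (\<Sum>j=i..n. q j) \<le> (\<Sum>j=i..n. p j)"
    and M_tail: "(\<Sum>j=i..n. p j) \<le> ?M * (\<Sum>j=i..n. q j)" if "i \<in> {1..n}" for i
  proof -
    have "tail_ratio n p q i \<in> ?R" using that by simp
    then have "?m \<le> tail_ratio n p q i" "tail_ratio n p q i \<le> ?M"
      unfolding min_ratio_def max_ratio_def using R(1) by simp_all
    then show "?m * (\<Sum>j=i..n. q j) \<le> (\<Sum>j=i..n. p j)" "(\<Sum>j=i..n. p j) \<le> ?M * (\<Sum>j=i..n. q j)"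
      using q_tail[OF that] by (simp_all add: tail_ratio_def field_simps)
  qed

  \<comment> \<open>Here \<open>c = u\<close>, \<open>d = v\<close>, \<open>r = ?m\<close> and
    \<open>R = 1\<close>: the mass \<open>?m\<close> at \<open>v\<close> restores what was
    subtracted from \<open>p\<close>, so the barycentre is \<open>u\<close>.\<close>
  have "1 * f u \<le> (\<Sum>i=1..n. (p i - ?m * q i) * (f (x i) - \<Phi> \<bar>x i - u\<bar>)) + ?m * (f v - \<Phi> \<bar>v - u\<bar>)"
  proof (rule jensen_steffensen_superadditive[OF x mono_x])
    have lin: "(\<Sum>i\<in>A. (p i - ?m * q i) * y i) = (\<Sum>i\<in>A. p i * y i) - ?m * (\<Sum>i\<in>A. q i * y i)" for A y
      by (simp add: sum_subtractf left_diff_distrib sum_distrib_left mult.assoc)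
    have lin1: "(\<Sum>i\<in>A. p i - ?m * q i) = (\<Sum>i\<in>A. p i) - ?m * (\<Sum>i\<in>A. q i)" for A
      using lin[of "\<lambda>_. 1"] by simp
    show "0 \<le> (\<Sum>j=1..i. p j - ?m * q j)" "0 \<le> (\<Sum>j=i..n. p j - ?m * q j)" if "i \<in> {1..n}" for i
      unfolding lin1 using m_head[OF that] m_tail[OF that] by simp_all
    show "(\<Sum>i=1..n. p i - ?m * q i) + ?m = 1"
      unfolding lin1 p1 q1 by simp
    show "(\<Sum>i=1..n. (p i - ?m * q i) * x i) + ?m * v = 1 * u"
      unfolding lin u_def v_def by simp
  qed (use u v m0 in simp_all)
  moreover have "(\<Sum>i=1..n. (p i - ?m * q i) * (f (x i) - \<Phi> \<bar>x i - u\<bar>)) =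
      (\<Sum>i=1..n. p i * f (x i)) - ?m * (\<Sum>i=1..n. q i * f (x i))
        - (\<Sum>i=1..n. (p i - ?m * q i) * \<Phi> \<bar>x i - u\<bar>)"
    by (simp add: sum_subtractf right_diff_distrib left_diff_distrib sum_distrib_left mult.assoc)
  moreover have diff: "(\<Sum>i=1..n. (q i - p i) * x i) = v - u"
    by (simp add: u_def v_def sum_subtractf left_diff_distrib)
  ultimately have first: "jensen_functional n f x p - ?m * jensen_functional n f x q
      \<ge> ?m * \<Phi> \<bar>\<Sum>i=1..n. (q i - p i) * x i\<bar> + (\<Sum>i=1..n. (p i - ?m * q i) * \<Phi> \<bar>x i - u\<bar>)"
    unfolding jensen_functional_def diff u_def[symmetric] v_def[symmetric]
    by (simp only: right_diff_distrib[of ?m] mult_1_left)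

  \<comment> \<open>The roles are exchanged: \<open>c = v\<close>, \<open>d = u\<close>,
    \<open>r = 1\<close> and \<open>R = ?M\<close>.\<close>
  have "?M * f v \<le> (\<Sum>i=1..n. (?M * q i - p i) * (f (x i) - \<Phi> \<bar>x i - v\<bar>)) + 1 * (f u - \<Phi> \<bar>u - v\<bar>)"
  proof (rule jensen_steffensen_superadditive[OF x mono_x])
    have lin: "(\<Sum>i\<in>A. (?M * q i - p i) * y i) = ?M * (\<Sum>i\<in>A. q i * y i) - (\<Sum>i\<in>A. p i * y i)" for A y
      by (simp add: sum_subtractf left_diff_distrib sum_distrib_left mult.assoc)
    have lin1: "(\<Sum>i\<in>A. ?M * q i - p i) = ?M * (\<Sum>i\<in>A. q i) - (\<Sum>i\<in>A. p i)" for A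
      using lin[of "\<lambda>_. 1"] by simp
    show "0 \<le> (\<Sum>j=1..i. ?M * q j - p j)" "0 \<le> (\<Sum>j=i..n. ?M * q j - p j)" if "i \<in> {1..n}" for i
      unfolding lin1 using M_head[OF that] M_tail[OF that] by simp_all
    show "(\<Sum>i=1..n. ?M * q i - p i) + 1 = ?M"
      unfolding lin1 p1 q1 by simp
    show "(\<Sum>i=1..n. (?M * q i - p i) * x i) + 1 * u = ?M * v"
      unfolding lin u_def v_def by simp
  qed (use u v m0 in simp_all)
  moreover have "(\<Sum>i=1..n. (?M * q i - p i) * (f (x i) - \<Phi> \<bar>x i - v\<bar>)) =
      ?M * (\<Sum>i=1..n. q i * f (x i)) - (\<Sum>i=1..n. p i * f (x i))
        - (\<Sum>i=1..n. (?M * q i - p i) * \<Phi> \<bar>x i - v\<bar>)"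
    by (simp add: sum_subtractf right_diff_distrib left_diff_distrib sum_distrib_left mult.assoc)
  moreover have diff': "(\<Sum>i=1..n. (p i - q i) * x i) = u - v"
    by (simp add: u_def v_def sum_subtractf left_diff_distrib)
  ultimately have "jensen_functional n f x p - ?M * jensen_functional n f x q
      \<le> - (\<Sum>i=1..n. (?M * q i - p i) * \<Phi> \<bar>x i - v\<bar>) - \<Phi> \<bar>\<Sum>i=1..n. (p i - q i) * x i\<bar>"
    unfolding jensen_functional_def diff' u_def[symmetric] v_def[symmetric]
    by (simp only: right_diff_distrib[of ?M] mult_1_left)
  with first show ?thesis unfolding u_def v_def ..
qed

end
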